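(* Let $I$ be a MOMILP instance, let $\varepsilon\in\mathbb{R}_{>0}$, let $\alpha\in\mathbb{R}_{>1}$, let $\mathsf{WS}_\alpha$ be an $\alpha$-approximation algorithm for the weighted sum scalarization of $I$, and let $x^{\mathrm{init}}\in X$ be a feasible solution with encoding length in $\mathcal{O}(\mathsf{poly}(\langle I\rangle))$. Then the set $R$ computed by the inner approximation algorithm described in the context, when $\mathsf{hpO}\text{-}\mathsf{WS}_\alpha$ is used as the plane separating oracle, is an $\alpha\cdot(1+\varepsilon)$-convex approximation set.
   Context: MOMILP. For $d,m,n\in\mathbb{N}_{>0}$, $Q\in\mathbb{Q}^{d\times n}$, $A\in\mathbb{Q}^{m\times n}$, $b\in\mathbb{Q}^m$ and $n_{\mathbb{R}},n_{\mathbb{Z}}\in\mathbb{N}_{\ge 0}$ with $n_{\mathbb{R}}+n_{\mathbb{Z}}=n$, a multi-objective mixed-integer linear program (MOMILP) is the problem $\min f(x)=Qx$ subject to $Ax\ge b$, $x\in\mathbb{R}^{n_{\mathbb{R}}}\times\mathbb{Z}^{n_{\mathbb{Z}}}$. $X$ denotes its set of feasible solutions and $Y=\{f(x):x\in X\}\subseteq\mathbb{R}^d$ its set of images. An instance $I$ need not be explicitly encoded in this form. Standing assumptions: $X\ne\emptyset$, $Y\subseteq\mathbb{R}^d_{\ge 0}$, and the number $d$ of objectives is a constant. $\langle\cdot\rangle$ denotes binary encoding length; inequalities between vectors are componentwise; sums of sets are Minkowski sums; $\mathsf{conv}$ is the convex hull. Convex approximation set. For a factor $\beta>1$, a set $R\subseteq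 X$ is a $\beta$-convex approximation set if for each $x\in X$ there is $v\in\mathsf{conv}\{f(x^* ):x^*\in R\}$ with $v\le\beta f(x)$. Approximate weighted sum oracle. For $w\in\mathbb{R}^d_{\ge0}$, the weighted sum scalarization is the single-objective problem $\min\{w^{\mathsf T}f(x):x\in X\}$. An $\alpha$-approximation algorithm $\mathsf{WS}_\alpha$ for it returns, on input $w$, a solution $x^*\in X$ with $w^{\mathsf T}f(x^* )\le\alpha\,w^{\mathsf T}f(x)$ for all $x\in X$; the returned solutions are assumed to have encoding length in $\mathcal{O}(\mathsf{poly}(\langle I\rangle))$. The oracle $\mathsf{hpO}\text{-}\mathsf{WS}_\alpha$, given a halfspace $H=\{z\in\mathbb{R}^d:w^{\mathsf T}z\ge c\}$, computes $x^*\gets\mathsf{WS}_\alpha(w)$ and returns $(\textit{inside},\emptyset)$ if $w^{\mathsf T}f(x^* )\ge c$ and $(\textit{not inside},x^* )$ otherwise. Facet-supporting halfspaces. For a polyhedron $\mathcal{P}$, $\mathcal{H}(\mathcal{P})$ is the set of halfspaces that contain $\mathcal{P}$ and whose boundary contains a facet of $\mathcal{P}$. Inner approximation algorithm (with oracle $\mathsf{hpO}$). Initialize $R=\{x^{\mathrm{init}}\}$, $k=1$, $F=\emptyset$, $\mathcal{A}^{(1)}=\{f(x^{\mathrm{init}})\}+\mathbb{R}^d_{\ge0}$. While $\mathcal{H}(\mathcal{A}^{(k)})\setminus F\ne\emptyset$: pick an arbitrary halfspace $H=\{z\in\mathbb{R}^d:w^{\mathsf T}z\ge c\}\in\mathcal{H}(\mathcal{A}^{(k)})\setminus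 F$; set $H_{1+\varepsilon}=\{z\in\mathbb{R}^d:(1+\varepsilon)w^{\mathsf T}z\ge c\}$; call $\mathsf{hpO}(H_{1+\varepsilon})$. If it returns $(\textit{not inside},x^* )$, set $R\gets R\cup\{x^*\}$, $k\gets k+1$, $\mathcal{A}^{(k)}\gets\mathsf{conv}\{f(x):x\in R\}+\mathbb{R}^d_{\ge0}$; otherwise set $F\gets F\cup\{H\}$. The set computed by the algorithm is $R$ at termination. *)

theory Defs
  imports
    "HOL-Analysis.Analysis"
    "HOL-Computational_Algebra.Polynomial"
    "HOL-Library.Log_Nat"
    "HOL-Library.Set_Algebras"
begin

text \<open>
  The number of objectives is constant and is given by the index type \<open>'d\<close>. The numbers of variables
  and of constraints belong to the instance: matrices and right-hand sides are functions of which
  only the entries with indices below these numbers are relevant, and solutions are lists. The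
  variables with index below \<open>num_real\<close> are the continuous ones, the following \<open>num_int\<close> ones the
  integer ones.
\<close>

record 'd momilp =
  num_real :: nat
  num_int :: nat
  num_constraints :: nat
  Q_mat :: "'d \<Rightarrow> nat \<Rightarrow> rat"
  A_mat :: "nat \<Rightarrow> nat \<Rightarrow> rat"
  b_vec :: "nat \<Rightarrow> rat"

definition num_vars :: "'d momilp \<Rightarrow> nat" where
  "num_vars P = num_real P + num_int P"

definition objective :: "'d::finite momilp \<Rightarrow> real list \<Rightarrow> real ^ 'd" where
  "objective P x = (\<chi> i. \<Sum>j<num_vars P. of_rat (Q_mat P i j) * x ! j)"

definition feasible :: "'d momilp \<Rightarrow> real list set" where
  "feasible P = {x. length x = num_vars P \<and>
     (\<forall>i<num_constraints P. (\<Sum>j<num_vars P. of_rat (A_mat P i j) * x ! j) \<ge> of_rat (b_vec P i)) \<and>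
     (\<forall>j\<in>{num_real P..<num_vars P}. x ! j \<in> \<int>)}"

definition is_momilp :: "'d::finite momilp \<Rightarrow> bool" where
  "is_momilp P \<longleftrightarrow> num_vars P > 0 \<and> num_constraints P > 0 \<and>
     feasible P \<noteq> {} \<and> (\<forall>x\<in>feasible P. 0 \<le> objective P x)"

definition convex_approximation_set :: "real \<Rightarrow> 'd::finite momilp \<Rightarrow> real list set \<Rightarrow> bool" where
  "convex_approximation_set \<beta> P R \<longleftrightarrow> R \<subseteq> feasible P \<and>
     (\<forall>x\<in>feasible P. \<exists>v\<in>convex hull (objective P ` R). v \<le> \<beta> *\<^sub>R objective P x)"

text \<open>Sign plus the binary digits of numerator and denominator in lowest terms.\<close>

definition rat_length :: "rat \<Rightarrow> nat" where
  "rat_length r = (case quotient_of r of (a, b) \<Rightarrow> 1 + floorlog 2 (nat \<bar>a\<bar>) + floorlog 2 (nat b))"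

definition rat_list_length :: "rat list \<Rightarrow> nat" where
  "rat_list_length qs = length qs + (\<Sum>q\<leftarrow>qs. rat_length q)"

text \<open>
  Instances are represented by bit strings, so that the encoding length of an instance is the length
  of the bit string. All solutions in \<open>S I\<close> have encoding length polynomial in that of \<open>I\<close>,
  uniformly for all instances \<open>I\<close> in a given class; in particular these solutions are rational.
\<close>

definition poly_encoding_length :: "bool list set \<Rightarrow> (bool list \<Rightarrow> real list set) \<Rightarrow> bool" where
  "poly_encoding_length \<I> S \<longleftrightarrow> (\<exists>p :: nat poly. \<forall>I\<in>\<I>. \<forall>x\<in>S I.
     \<exists>q. x = map of_rat q \<and> rat_list_length q \<le> poly p (length I))"

definition halfspace :: "real ^ 'd::finite \<Rightarrow> real \<Rightarrow> (real ^ 'd) set" where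
  "halfspace w c = {z. w \<bullet> z \<ge> c}"

definition facet_halfspaces :: "(real ^ 'd::finite) set \<Rightarrow> (real ^ 'd) set set" where
  "facet_halfspaces P = {H. (\<exists>w c. w \<noteq> 0 \<and> H = halfspace w c) \<and> P \<subseteq> H \<and>
     (\<exists>F. F facet_of P \<and> F \<subseteq> frontier H)}"

definition ws_approximation ::
    "real \<Rightarrow> 'd::finite momilp \<Rightarrow> (real ^ 'd \<Rightarrow> real list) \<Rightarrow> bool" where
  "ws_approximation \<alpha> P WS \<longleftrightarrow> (\<forall>w\<ge>0. WS w \<in> feasible P \<and>
     (\<forall>x\<in>feasible P. w \<bullet> objective P (WS w) \<le> \<alpha> * (w \<bullet> objective P x)))"

datatype 'x answer = Inside | Not_Inside 'x

text \<open>
  A halfspace determines its normal vector only up to positive scaling, and the solution returned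
  for the weighted sum problem may depend on the scaling. The oracle is therefore a relation between
  halfspaces and answers which admits every choice of a normal vector.
\<close>

definition hpO_WS ::
    "'d::finite momilp \<Rightarrow> (real ^ 'd \<Rightarrow> real list) \<Rightarrow> (real ^ 'd) set \<Rightarrow> real list answer \<Rightarrow> bool" where
  "hpO_WS P WS H a \<longleftrightarrow> (\<exists>w c. w \<noteq> 0 \<and> H = halfspace w c \<and>
     a = (let x = WS w in if w \<bullet> objective P x \<ge> c then Inside else Not_Inside x))"

text \<open>
  A state \<open>(R, A, F)\<close> consists of the current set of solutions, the current inner approximation and
  the set of halfspaces found to be facet-supporting up to the factor \<open>1 + \<epsilon>\<close>. The transition
  relation covers every choice of a halfspace and every answer the oracle may give.
\<close>

type_synonym ('x, 'd) inner_state = "'x set \<times> (real ^ 'd) set \<times> (real ^ 'd) set set"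

definition inner_init :: "('x \<Rightarrow> real ^ 'd::finite) \<Rightarrow> 'x \<Rightarrow> ('x, 'd) inner_state" where
  "inner_init f xinit = ({xinit}, {f xinit} + {z. 0 \<le> z}, {})"

inductive inner_step ::
    "('x \<Rightarrow> real ^ 'd::finite) \<Rightarrow> real \<Rightarrow> ((real ^ 'd) set \<Rightarrow> 'x answer \<Rightarrow> bool) \<Rightarrow>
     ('x, 'd) inner_state \<Rightarrow> ('x, 'd) inner_state \<Rightarrow> bool"
  for f :: "'x \<Rightarrow> real ^ 'd::finite" and \<epsilon> and hpO where
  inside:
    "\<lbrakk>H \<in> facet_halfspaces A - F; w \<noteq> 0; H = halfspace w c;
      hpO (halfspace ((1 + \<epsilon>) *\<^sub>R w) c) Inside\<rbrakk>
     \<Longrightarrow> inner_step f \<epsilon> hpO (R, A, F) (R, A, insert H F)"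
| not_inside:
    "\<lbrakk>H \<in> facet_halfspaces A - F; w \<noteq> 0; H = halfspace w c;
      hpO (halfspace ((1 + \<epsilon>) *\<^sub>R w) c) (Not_Inside x); R' = insert x R\<rbrakk>
     \<Longrightarrow> inner_step f \<epsilon> hpO (R, A, F) (R', convex hull (f ` R') + {z. 0 \<le> z}, F)"

definition inner_terminates ::
    "('x \<Rightarrow> real ^ 'd::finite) \<Rightarrow> real \<Rightarrow> ((real ^ 'd) set \<Rightarrow> 'x answer \<Rightarrow> bool) \<Rightarrow> 'x \<Rightarrow> bool" where
  "inner_terminates f \<epsilon> hpO xinit \<longleftrightarrow>
     \<not> (\<exists>\<sigma>. \<sigma> 0 = inner_init f xinit \<and> (\<forall>i::nat. inner_step f \<epsilon> hpO (\<sigma> i) (\<sigma> (Suc i))))"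

definition inner_computes ::
    "('x \<Rightarrow> real ^ 'd::finite) \<Rightarrow> real \<Rightarrow> ((real ^ 'd) set \<Rightarrow> 'x answer \<Rightarrow> bool) \<Rightarrow> 'x \<Rightarrow> 'x set \<Rightarrow> bool" where
  "inner_computes f \<epsilon> hpO xinit R \<longleftrightarrow>
     (\<exists>A F. (inner_step f \<epsilon> hpO)\<^sup>*\<^sup>* (inner_init f xinit) (R, A, F) \<and> facet_halfspaces A - F = {})"

end

theory Submission
  imports Defs
begin

text \<open>
  Every inner approximation is the upper hull \<open>conv V + \<real>\<^sup>d\<^sub>\<ge>\<^sub>0\<close> of finitely many images, and the argument
  rests on three facts about such sets. They are polyhedra (\<open>polyhedron_upper_hull\<close>), because every
  face of a Minkowski sum is a sum of faces of the summands; since they are full-dimensional, they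
  have only finitely many facet-supporting halfspaces (\<open>finite_facet_halfspaces\<close>) and are the
  intersection of these (\<open>Inter_facet_halfspaces\<close>); and a halfspace can contain one of them only if
  its normal vector is nonnegative (\<open>upper_hull_normal_nonneg\<close>), so that the weighted sum oracle is
  only ever asked about weights for which its guarantee holds.

  For the approximation factor, suppose that the oracle answers ``inside'' for the facet-supporting
  halfspace \<open>w \<bullet> z \<ge> c\<close>. The solution that it computed has weighted value at least \<open>c / (1 + \<epsilon>)\<close>
  and at most \<open>\<alpha>\<close> times that of any feasible \<open>x\<close>, so \<open>\<alpha> (1 + \<epsilon>) f(x)\<close> satisfies the inequality.
  At termination this is the case for all facets, so \<open>\<alpha> (1 + \<epsilon>) f(x)\<close> lies in the upper hull of
  the images of \<open>R\<close>, which means that it is dominated by a convex combination of them.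

  For termination, the bound on encoding lengths leaves only finitely many solutions that the oracle
  can return for one instance, and hence only finitely many inner approximations and halfspaces that
  can ever occur. An answer ``not inside'' always brings a new solution: its image violates
  \<open>w \<bullet> z \<ge> c\<close> (here nonnegativity of the images enters), whereas the images of \<open>R\<close> satisfy it.
  An answer ``inside'' brings a new halfspace. Hence the number of solutions and halfspaces
  not yet found decreases in every step (\<open>inner_step_progress\<close>).
\<close>

section \<open>Halfspaces and their normal vectors\<close>

lemma nonneg_of_bounded_below_along_ray:
  fixes w :: "'a::real_inner"
  assumes "\<And>s. s \<ge> 0 \<Longrightarrow> c \<le> w \<bullet> (a + s *\<^sub>R u)"
  shows "0 \<le> w \<bullet> u"
proof (rule ccontr)
  assume "\<not> 0 \<le> w \<bullet> u"
  then have neg: "w \<bullet> u < 0" by simp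
  define s where "s = (\<bar>c - w \<bullet> a\<bar> + 1) / (- (w \<bullet> u))"
  have "s \<ge> 0" using neg by (simp add: s_def divide_nonneg_neg)
  moreover have "s * (w \<bullet> u) = - (\<bar>c - w \<bullet> a\<bar> + 1)" using neg by (simp add: s_def)
  ultimately show False using assms[of s] by (simp add: inner_add_right)
qed

text \<open>
  The inclusion forces \<open>w'\<close> to be nonnegative on all recession directions \<open>u\<close> of the first halfspace.
  Testing with the negative of the component of \<open>w'\<close> orthogonal to \<open>w\<close> shows that this component
  vanishes.
\<close>

lemma halfspace_subset_imp_scaled:
  fixes w w' :: "real ^ 'd::finite"
  assumes "w \<noteq> 0" and sub: "halfspace w c \<subseteq> halfspace w' c'"
  obtains t where "t \<ge> 0" "w' = t *\<^sub>R w" "c' \<le> t * c"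
proof -
  define z where "z = (c / (w \<bullet> w)) *\<^sub>R w"
  have z: "w \<bullet> z = c" using \<open>w \<noteq> 0\<close> by (simp add: z_def)
  have recession: "0 \<le> w' \<bullet> u" if "0 \<le> w \<bullet> u" for u
  proof (rule nonneg_of_bounded_below_along_ray)
    fix s :: real assume "s \<ge> 0"
    then have "z + s *\<^sub>R u \<in> halfspace w c"
      using that z by (simp add: halfspace_def inner_add_right)
    then show "c' \<le> w' \<bullet> (z + s *\<^sub>R u)" using sub by (auto simp: halfspace_def)
  qed
  define t where "t = (w \<bullet> w') / (w \<bullet> w)"
  define v where "v = w' - t *\<^sub>R w"
  have orth: "w \<bullet> v = 0" using \<open>w \<noteq> 0\<close> by (simp add: v_def t_def inner_diff_right)
  then have "w' \<bullet> v = v \<bullet> v" by (simp add: v_def inner_diff_left inner_commute)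
  moreover have "0 \<le> w' \<bullet> (- v)" using orth by (intro recession) simp
  ultimately have "v \<bullet> v \<le> 0" by simp
  then have "v = 0" using inner_gt_zero_iff[of v] by fastforce
  then have w': "w' = t *\<^sub>R w" by (simp add: v_def)
  have "t \<ge> 0" using recession[of w] by (simp add: t_def inner_commute)
  moreover have "z \<in> halfspace w' c'" using sub z by (auto simp: halfspace_def)
  then have "c' \<le> t * c" using z by (simp add: halfspace_def w')
  ultimately show ?thesis using w' that by blast
qed

lemma halfspace_eq_imp_scaled:
  fixes w w' :: "real ^ 'd::finite"
  assumes "w \<noteq> 0" "w' \<noteq> 0" and eq: "halfspace w c = halfspace w' c'"
  obtains t where "t > 0" "w' = t *\<^sub>R w" "c' = t * c"
proof -
  obtain t where t: "t \<ge> 0" "w' = t *\<^sub>R w" "c' \<le> t * c"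
    using halfspace_subset_imp_scaled[of w c w' c'] assms by blast
  obtain s where s: "s \<ge> 0" "w = s *\<^sub>R w'" "c \<le> s * c'"
    using halfspace_subset_imp_scaled[of w' c' w c] assms by blast
  have "t > 0" using t assms by (cases "t = 0") auto
  have "w = (s * t) *\<^sub>R w" using s(2) t(2) by simp
  then have "(s * t - 1) *\<^sub>R w = 0" by (simp add: scaleR_left_diff_distrib)
  then have st: "t * s = 1" using \<open>w \<noteq> 0\<close> by (simp add: mult.commute)
  have "t * c \<le> t * (s * c')" using \<open>t > 0\<close> s(3) by (intro mult_left_mono) auto
  then have "t * c \<le> c'" using st by (simp flip: mult.assoc)
  then show ?thesis using that \<open>t > 0\<close> t by fastforce
qed

section \<open>Facet-supporting halfspaces of full-dimensional polyhedra\<close>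

text \<open>
  A facet of a full-dimensional set spans the hyperplane that bounds a supporting halfspace, and an
  interior point of the set tells on which side of this hyperplane the halfspace lies.
\<close>

lemma facet_halfspace_unique:
  fixes P :: "(real ^ 'd::finite) set"
  assumes int: "interior P \<noteq> {}" and F: "F facet_of P"
    and 1: "w1 \<noteq> 0" "P \<subseteq> halfspace w1 c1" "F \<subseteq> frontier (halfspace w1 c1)"
    and 2: "w2 \<noteq> 0" "P \<subseteq> halfspace w2 c2" "F \<subseteq> frontier (halfspace w2 c2)"
  shows "halfspace w1 c1 \<subseteq> halfspace w2 c2"
proof -
  have span: "affine hull F = {z. w \<bullet> z = c}"
    if "w \<noteq> 0" "F \<subseteq> frontier (halfspace w c)" for w :: "real ^ 'd" and c
  proof -
    have "F \<subseteq> {z. w \<bullet> z = c}" using that by (simp add: halfspace_def frontier_halfspace_ge)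
    then have "affine hull F \<subseteq> {z. w \<bullet> z = c}" by (simp add: affine_hyperplane subset_hull)
    moreover have "aff_dim (affine hull F) = aff_dim {z. w \<bullet> z = c}"
      using F int that(1) by (simp add: facet_of_def aff_dim_nonempty_interior)
    moreover have "affine hull F \<noteq> {}" using F by (simp add: facet_of_def)
    ultimately show ?thesis by (intro affine_dim_equal) (auto simp: affine_hyperplane)
  qed
  have hyp: "{z. w1 \<bullet> z = c1} = {z. w2 \<bullet> z = c2}"
    using span[of w1 c1] span[of w2 c2] 1 2 by simp
  obtain p where p: "p \<in> interior P" using int by blast
  have p1: "w1 \<bullet> p > c1" and p2: "w2 \<bullet> p > c2"
    using p interior_mono[OF 1(2)] interior_mono[OF 2(2)] 1(1) 2(1)
    by (auto simp: halfspace_def)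
  show ?thesis
  proof
    fix z assume z: "z \<in> halfspace w1 c1"
    show "z \<in> halfspace w2 c2"
    proof (rule ccontr)
      assume "z \<notin> halfspace w2 c2"
      then have z2: "w2 \<bullet> z < c2" by (simp add: halfspace_def)
      \<comment> \<open>The segment from \<open>z\<close> to \<open>p\<close> crosses the second hyperplane at \<open>q\<close>, which lies strictly
        inside the first halfspace.\<close>
      define u where "u = (c2 - w2 \<bullet> z) / (w2 \<bullet> p - w2 \<bullet> z)"
      have u: "0 < u" "u < 1" using p2 z2 by (auto simp: u_def divide_simps)
      define q where "q = z + u *\<^sub>R (p - z)"
      have "w2 \<bullet> q = c2"
        using p2 z2 by (simp add: q_def u_def inner_add_right inner_diff_right)
      then have "w1 \<bullet> q = c1" using hyp by blast
      moreover have "w1 \<bullet> q = (1 - u) * (w1 \<bullet> z) + u * (w1 \<bullet> p)"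
        by (simp add: q_def inner_add_right inner_diff_right algebra_simps)
      moreover have "(1 - u) * (w1 \<bullet> z) \<ge> (1 - u) * c1"
        using z u by (intro mult_left_mono) (auto simp: halfspace_def)
      moreover have "u * (w1 \<bullet> p) > u * c1" using u p1 by simp
      ultimately show False by (simp add: algebra_simps)
    qed
  qed
qed

lemma finite_facet_halfspaces:
  fixes P :: "(real ^ 'd::finite) set"
  assumes "polyhedron P" and int: "interior P \<noteq> {}"
  shows "finite (facet_halfspaces P)"
proof -
  have "\<forall>H\<in>facet_halfspaces P. \<exists>F. F facet_of P \<and> F \<subseteq> frontier H"
    by (auto simp: facet_halfspaces_def)
  then obtain g where g: "\<And>H. H \<in> facet_halfspaces P \<Longrightarrow> g H facet_of P \<and> g H \<subseteq> frontier H"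
    by metis
  have "inj_on g (facet_halfspaces P)"
  proof (rule inj_onI)
    fix H1 H2 assume H: "H1 \<in> facet_halfspaces P" "H2 \<in> facet_halfspaces P" "g H1 = g H2"
    obtain w1 c1 w2 c2 where w: "w1 \<noteq> 0" "H1 = halfspace w1 c1" "w2 \<noteq> 0" "H2 = halfspace w2 c2"
      using H by (auto simp: facet_halfspaces_def)
    have sub: "P \<subseteq> halfspace w1 c1" "P \<subseteq> halfspace w2 c2"
      using H w by (auto simp: facet_halfspaces_def)
    have "g H1 facet_of P" "g H1 \<subseteq> frontier (halfspace w1 c1)" "g H1 \<subseteq> frontier (halfspace w2 c2)"
      using g[OF H(1)] g[OF H(2)] H(3) w by auto
    then show "H1 = H2"
      using facet_halfspace_unique[OF int] w sub by (metis subset_antisym)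
  qed
  moreover have "g ` facet_halfspaces P \<subseteq> {F. F facet_of P}" using g by blast
  then have "finite (g ` facet_halfspaces P)"
    using finite_polyhedron_facets[OF assms(1)] finite_subset by blast
  ultimately show ?thesis using finite_imageD by blast
qed

lemma Inter_facet_halfspaces:
  fixes P :: "(real ^ 'd::finite) set"
  assumes "polyhedron P" and int: "interior P \<noteq> {}"
  shows "\<Inter>(facet_halfspaces P) = P"
proof
  show "P \<subseteq> \<Inter>(facet_halfspaces P)" by (auto simp: facet_halfspaces_def)
  obtain \<F> where fin: "finite \<F>" and P: "P = affine hull P \<inter> \<Inter>\<F>"
    and ex: "\<forall>h\<in>\<F>. \<exists>a b. a \<noteq> 0 \<and> h = {x. a \<bullet> x \<le> b}"
    and min: "\<And>\<F>'. \<F>' \<subset> \<F> \<Longrightarrow> P \<subset> affine hull P \<inter> \<Inter>\<F>'"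
    using assms(1) unfolding polyhedron_Int_affine_minimal by meson
  obtain a b where ab: "\<And>h. h \<in> \<F> \<Longrightarrow> a h \<noteq> 0 \<and> h = {x. a h \<bullet> x \<le> b h}"
    using ex by metis
  have "\<F> \<subseteq> facet_halfspaces P"
  proof
    fix h assume h: "h \<in> \<F>"
    have hs: "h = halfspace (- a h) (- b h)" "- a h \<noteq> 0" using ab[OF h] by (auto simp: halfspace_def)
    have "(P \<inter> {x. a h \<bullet> x = b h}) facet_of P"
      using facet_of_polyhedron_explicit[OF fin P ab min] h by blast
    moreover have "P \<inter> {x. a h \<bullet> x = b h} \<subseteq> frontier h"
      using frontier_halfspace_le[of "a h" "b h"] ab[OF h] by auto
    moreover have "P \<subseteq> h" using P h by blast
    ultimately show "h \<in> facet_halfspaces P"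
      using hs unfolding facet_halfspaces_def by blast
  qed
  moreover have "P = \<Inter>\<F>" using P affine_hull_nonempty_interior[OF int] by simp
  ultimately show "\<Inter>(facet_halfspaces P) \<subseteq> P" by blast
qed

section \<open>Upper hulls of finite sets\<close>

text \<open>
  The summands are recovered from a face \<open>G\<close> by projecting its representations. They again add up
  to \<open>G\<close>: if \<open>s + t\<close> and \<open>s' + t'\<close> lie in \<open>G\<close>, then so does their midpoint, which is also the
  midpoint of \<open>s + t'\<close> and \<open>s' + t\<close>; hence these points lie in the face, too.
\<close>

lemma face_of_set_plus:
  fixes S T :: "'a::real_vector set"
  assumes "convex S" "convex T" "G face_of S + T"
  obtains F F' where "F face_of S" "F' face_of T" "G = F + F'"
proof -
  have G: "G \<subseteq> S + T" "convex G"
    and ext: "\<And>a b x. a \<in> S + T \<Longrightarrow> b \<in> S + T \<Longrightarrow> x \<in> G \<Longrightarrow> x \<in> open_segment a b \<Longrightarrow> a \<in> G \<and> b \<in> G"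
    using assms(3) by (auto simp: face_of_def)
  have part: "{s \<in> A. \<exists>t\<in>B. s + t \<in> G} face_of A" if "convex A" "convex B" "A + B = S + T" for A B
    unfolding face_of_def
  proof (intro conjI ballI impI)
    show "{s \<in> A. \<exists>t\<in>B. s + t \<in> G} \<subseteq> A" by blast
    show "convex {s \<in> A. \<exists>t\<in>B. s + t \<in> G}"
    proof (rule convexI)
      fix x y and u v :: real
      assume x: "x \<in> {s \<in> A. \<exists>t\<in>B. s + t \<in> G}" and y: "y \<in> {s \<in> A. \<exists>t\<in>B. s + t \<in> G}"
        and uv: "0 \<le> u" "0 \<le> v" "u + v = 1"
      obtain p q where pq: "p \<in> B" "x + p \<in> G" "q \<in> B" "y + q \<in> G" using x y by blast
      have "u *\<^sub>R (x + p) + v *\<^sub>R (y + q) \<in> G" using pq uv G(2) by (auto intro: convexD)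
      then have "(u *\<^sub>R x + v *\<^sub>R y) + (u *\<^sub>R p + v *\<^sub>R q) \<in> G" by (simp add: algebra_simps)
      moreover have "u *\<^sub>R p + v *\<^sub>R q \<in> B" using pq uv that(2) by (auto intro: convexD)
      moreover have "u *\<^sub>R x + v *\<^sub>R y \<in> A" using x y uv that(1) by (auto intro: convexD)
      ultimately show "u *\<^sub>R x + v *\<^sub>R y \<in> {s \<in> A. \<exists>t\<in>B. s + t \<in> G}" by blast
    qed
    fix a b x assume ab: "a \<in> A" "b \<in> A" and x: "x \<in> {s \<in> A. \<exists>t\<in>B. s + t \<in> G}"
      and seg: "x \<in> open_segment a b"
    obtain t where t: "t \<in> B" "x + t \<in> G" using x by blast
    have "t + x \<in> open_segment (t + a) (t + b)" using seg by (simp add: open_segment_translation_eq)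
    then have "x + t \<in> open_segment (a + t) (b + t)" by (simp add: add.commute)
    moreover have "a + t \<in> S + T" "b + t \<in> S + T" using ab t that(3) by blast+
    ultimately have "a + t \<in> G \<and> b + t \<in> G" using ext t(2) by blast
    then show "a \<in> {s \<in> A. \<exists>t\<in>B. s + t \<in> G}" "b \<in> {s \<in> A. \<exists>t\<in>B. s + t \<in> G}" using ab t by blast+
  qed
  define F where "F = {s \<in> S. \<exists>t\<in>T. s + t \<in> G}"
  define F' where "F' = {t \<in> T. \<exists>s\<in>S. t + s \<in> G}"
  have "F face_of S" unfolding F_def using part[of S T] assms by simp
  moreover have "F' face_of T" unfolding F'_def using part[of T S] assms by (simp add: add.commute)
  moreover have "G = F + F'"
  proof
    show "G \<subseteq> F + F'"
    proof
      fix g assume g: "g \<in> G"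
      then obtain s t where st: "s \<in> S" "t \<in> T" "g = s + t" using G(1) by (auto simp: set_plus_def)
      then have "s \<in> F" "t \<in> F'" using g by (auto simp: F_def F'_def add.commute)
      then show "g \<in> F + F'" using st by blast
    qed
    show "F + F' \<subseteq> G"
    proof
      fix g assume "g \<in> F + F'"
      then obtain s t' where g: "g = s + t'" "s \<in> F" "t' \<in> F'" by (auto elim: set_plus_elim)
      obtain t s' where w: "t \<in> T" "s + t \<in> G" "s' \<in> S" "s' + t' \<in> G"
        using g by (auto simp: F_def F'_def add.commute)
      have mem: "s + t' \<in> S + T" "s' + t \<in> S + T" using g w by (auto simp: F_def F'_def)
      define m where "m = (1/2) *\<^sub>R (s + t) + (1/2) *\<^sub>R (s' + t')"
      have m: "m \<in> G" unfolding m_def using w G(2) by (intro convexD) auto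
      have mid: "m = midpoint (s + t') (s' + t)" by (simp add: m_def midpoint_def algebra_simps)
      show "g \<in> G"
      proof (cases "s + t' = s' + t")
        case True
        then show ?thesis using m mid g by simp
      next
        case False
        then have "m \<in> open_segment (s + t') (s' + t)" using mid by simp
        then show ?thesis using ext mem m g by blast
      qed
    qed
  qed
  ultimately show ?thesis using that by blast
qed

lemma polyhedron_polytope_plus_polyhedron:
  fixes S T :: "'a::euclidean_space set"
  assumes "polytope S" "polyhedron T"
  shows "polyhedron (S + T)"
  unfolding polyhedron_eq_finite_faces
proof (intro conjI)
  have "S + T = (\<Union>x\<in>S. \<Union>y\<in>T. {x + y})" by (auto simp: set_plus_def)
  then show "closed (S + T)"
    using compact_closed_sums[of S T] assms
    by (simp add: polytope_imp_compact polyhedron_imp_closed)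
  have conv: "convex S" "convex T" using assms by (auto simp: polytope_imp_convex polyhedron_imp_convex)
  then show "convex (S + T)" by (rule convex_set_plus)
  have "{G. G face_of S + T} \<subseteq> (\<lambda>(F, F'). F + F') ` ({F. F face_of S} \<times> {F'. F' face_of T})"
  proof
    fix G assume "G \<in> {G. G face_of S + T}"
    then obtain F F' where "F face_of S" "F' face_of T" "G = F + F'"
      using face_of_set_plus[OF conv] by blast
    then show "G \<in> (\<lambda>(F, F'). F + F') ` ({F. F face_of S} \<times> {F'. F' face_of T})" by auto
  qed
  moreover have "finite ({F. F face_of S} \<times> {F'. F' face_of T})"
    using assms by (simp add: finite_polytope_faces finite_polyhedron_faces)
  ultimately show "finite {G. G face_of S + T}" by (meson finite_imageI finite_subset)
qed

lemma polyhedron_nonneg_orthant: "polyhedron {z :: real ^ 'd::finite. 0 \<le> z}"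
proof -
  have "{z :: real ^ 'd. 0 \<le> z} = \<Inter>(range (\<lambda>i. {z. axis i 1 \<bullet> z \<ge> 0}))"
    by (auto simp: less_eq_vec_def inner_axis')
  then show ?thesis by (auto intro!: polyhedron_Inter simp: polyhedron_halfspace_ge)
qed

definition upper_hull :: "(real ^ 'd::finite) set \<Rightarrow> (real ^ 'd) set" where
  "upper_hull V = convex hull V + {z. 0 \<le> z}"

lemma polyhedron_upper_hull: "finite V \<Longrightarrow> polyhedron (upper_hull V)"
  unfolding upper_hull_def
  by (intro polyhedron_polytope_plus_polyhedron polyhedron_nonneg_orthant)
    (auto simp: polytope_def)

lemma upper_hull_add: "v \<in> V \<Longrightarrow> 0 \<le> z \<Longrightarrow> v + z \<in> upper_hull V"
  unfolding upper_hull_def by (auto intro: hull_inc)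

lemma interior_upper_hull:
  fixes V :: "(real ^ 'd::finite) set"
  assumes "V \<noteq> {}"
  shows "interior (upper_hull V) \<noteq> {}"
proof -
  obtain v where v: "v \<in> V" using assms by blast
  have "box v (v + 1) \<subseteq> upper_hull V"
  proof
    fix z assume "z \<in> box v (v + 1)"
    then have "0 \<le> z - v" by (auto simp: mem_box_cart less_eq_vec_def less_imp_le)
    then show "z \<in> upper_hull V" using upper_hull_add[OF v, of "z - v"] by simp
  qed
  then have "box v (v + 1) \<subseteq> interior (upper_hull V)" by (simp add: interior_maximal open_box)
  moreover have "v + (\<chi> i. 1/2) \<in> box v (v + 1)" by (simp add: mem_box_cart)
  ultimately show ?thesis by blast
qed

lemma upper_hull_normal_nonneg:
  fixes V :: "(real ^ 'd::finite) set"
  assumes "V \<noteq> {}" "upper_hull V \<subseteq> halfspace w c"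
  shows "0 \<le> w"
  unfolding less_eq_vec_def
proof
  fix i
  obtain v where v: "v \<in> V" using assms by blast
  have "0 \<le> w \<bullet> axis i 1"
  proof (rule nonneg_of_bounded_below_along_ray)
    fix s :: real assume "s \<ge> 0"
    then have "v + s *\<^sub>R axis i 1 \<in> upper_hull V"
      by (intro upper_hull_add v) (auto simp: less_eq_vec_def axis_def)
    then show "c \<le> w \<bullet> (v + s *\<^sub>R axis i 1)" using assms(2) by (auto simp: halfspace_def)
  qed
  then show "0 $ i \<le> w $ i" by (simp add: inner_axis)
qed

lemma facet_halfspace_normal_nonneg:
  assumes "V \<noteq> {}" "halfspace w c \<in> facet_halfspaces (upper_hull V)"
  shows "0 \<le> w"
  using assms upper_hull_normal_nonneg unfolding facet_halfspaces_def by blast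

section \<open>Finiteness from bounded encoding length\<close>

lemma finite_rat_length_le: "finite {r. rat_length r \<le> n}"
proof -
  have "quotient_of ` {r. rat_length r \<le> n} \<subseteq> {- (2 ^ n)..2 ^ n} \<times> {0..2 ^ n}"
  proof clarify
    fix r a b assume len: "rat_length r \<le> n" and q: "(a, b) = quotient_of r"
    have b: "b > 0" using quotient_of_denom_pos q by metis
    have "floorlog 2 (nat \<bar>a\<bar>) \<le> n" "floorlog 2 (nat b) \<le> n"
      using len by (auto simp: rat_length_def simp flip: q)
    then have "nat \<bar>a\<bar> < 2 ^ n" "nat b < 2 ^ n" by (auto dest: floorlog_leD)
    then have "\<bar>a\<bar> < 2 ^ n" "b < 2 ^ n" by (auto simp: nat_less_iff)
    then show "a \<in> {- (2 ^ n)..2 ^ n} \<and> b \<in> {0..2 ^ n}" using b by auto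
  qed
  then have "finite (quotient_of ` {r. rat_length r \<le> n})" by (rule finite_subset) auto
  moreover have "inj_on quotient_of {r. rat_length r \<le> n}"
    by (auto intro: inj_onI quotient_of_inject)
  ultimately show ?thesis using finite_imageD by blast
qed

lemma finite_rat_list_length_le: "finite {qs. rat_list_length qs \<le> n}"
proof (rule finite_subset)
  show "{qs. rat_list_length qs \<le> n} \<subseteq> {qs. set qs \<subseteq> {r. rat_length r \<le> n} \<and> length qs \<le> n}"
  proof clarify
    fix qs assume len: "rat_list_length qs \<le> n"
    then have sum: "(\<Sum>q\<leftarrow>qs. rat_length q) \<le> n" and "length qs \<le> n"
      by (auto simp: rat_list_length_def)
    moreover have "rat_length q \<le> n" if "q \<in> set qs" for q
      using member_le_sum_list[of "rat_length q" "map rat_length qs"] that sum by force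
    ultimately show "set qs \<subseteq> {r. rat_length r \<le> n} \<and> length qs \<le> n" by blast
  qed
  show "finite {qs. set qs \<subseteq> {r. rat_length r \<le> n} \<and> length qs \<le> n}"
    by (intro finite_lists_length_le finite_rat_length_le)
qed

lemma finite_of_poly_encoding_length:
  assumes "poly_encoding_length \<I> S" "I \<in> \<I>"
  shows "finite (S I)"
proof -
  obtain p where p: "\<forall>x\<in>S I. \<exists>q. x = map of_rat q \<and> rat_list_length q \<le> poly p (length I)"
    using assms unfolding poly_encoding_length_def by blast
  then have "S I \<subseteq> map of_rat ` {q. rat_list_length q \<le> poly p (length I)}" by blast
  then show ?thesis using finite_rat_list_length_le finite_subset by blast
qed

section \<open>Answers of the weighted sum oracle\<close>

lemma hpO_WS_total:
  fixes P :: "'d::finite momilp" and v :: "real ^ 'd"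
  assumes "v \<noteq> 0"
  obtains a where "hpO_WS P WS (halfspace v c) a"
  using assms unfolding hpO_WS_def by blast

text \<open>
  The normal vector with which the oracle works is a positive multiple of the given one, and both
  sides of the inequality scale alike.
\<close>

lemma hpO_WS_Inside:
  fixes v :: "real ^ 'd::finite"
  assumes "hpO_WS P WS (halfspace v c) Inside" "ws_approximation \<alpha> P WS"
    and "v \<noteq> 0" "0 \<le> v" "x \<in> feasible P"
  shows "c \<le> \<alpha> * (v \<bullet> objective P x)"
proof -
  obtain w d where w: "w \<noteq> 0" "halfspace v c = halfspace w d" "d \<le> w \<bullet> objective P (WS w)"
    using assms(1) unfolding hpO_WS_def by (auto simp: Let_def split: if_splits)
  obtain t where t: "t > 0" "w = t *\<^sub>R v" "d = t * c"
    using halfspace_eq_imp_scaled[OF assms(3) w(1,2)] by blast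
  have "0 \<le> w" using t assms(4) by (simp add: less_eq_vec_def)
  then have "w \<bullet> objective P (WS w) \<le> \<alpha> * (w \<bullet> objective P x)"
    using assms(2,5) unfolding ws_approximation_def by blast
  then have "t * c \<le> t * (\<alpha> * (v \<bullet> objective P x))" using w(3) t by simp
  then show ?thesis using t(1) by simp
qed

lemma hpO_WS_Not_Inside:
  fixes v :: "real ^ 'd::finite"
  assumes "hpO_WS P WS (halfspace v c) (Not_Inside x)" "v \<noteq> 0" "0 \<le> v"
  shows "x \<in> WS ` {w. 0 \<le> w}" "v \<bullet> objective P x < c"
proof -
  obtain w d where w: "w \<noteq> 0" "halfspace v c = halfspace w d" "w \<bullet> objective P x < d" "x = WS w"
    using assms(1) unfolding hpO_WS_def by (auto simp: Let_def split: if_splits)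
  obtain t where t: "t > 0" "w = t *\<^sub>R v" "d = t * c"
    using halfspace_eq_imp_scaled[OF assms(2) w(1,2)] by blast
  have "0 \<le> w" using t assms(3) by (simp add: less_eq_vec_def)
  then show "x \<in> WS ` {w. 0 \<le> w}" using w(4) by blast
  show "v \<bullet> objective P x < c" using w(3) t by simp
qed

section \<open>Progress of the inner approximation algorithm\<close>

definition possible_halfspaces :: "('x \<Rightarrow> real ^ 'd::finite) \<Rightarrow> 'x set \<Rightarrow> (real ^ 'd) set set" where
  "possible_halfspaces f S = (\<Union>R\<in>Pow S - {{}}. facet_halfspaces (upper_hull (f ` R)))"

lemma finite_possible_halfspaces:
  assumes "finite S"
  shows "finite (possible_halfspaces f S)"
  unfolding possible_halfspaces_def
proof (rule finite_UN_I)
  show "finite (Pow S - {{}})" using assms by simp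
  fix R assume "R \<in> Pow S - {{}}"
  then have "finite (f ` R)" "f ` R \<noteq> {}" using assms finite_subset by auto
  then show "finite (facet_halfspaces (upper_hull (f ` R)))"
    by (intro finite_facet_halfspaces polyhedron_upper_hull interior_upper_hull)
qed

text \<open>
  \<open>S\<close> collects the solutions that the algorithm may come across, and \<open>\<beta>\<close> is the approximation factor
  that is certified for every halfspace in \<open>F\<close>.
\<close>

fun inner_invariant ::
    "'d::finite momilp \<Rightarrow> real list set \<Rightarrow> real \<Rightarrow> (real list, 'd) inner_state \<Rightarrow> bool" where
  "inner_invariant P S \<beta> (R, A, F) \<longleftrightarrow>
     R \<noteq> {} \<and> R \<subseteq> S \<and> A = upper_hull (objective P ` R) \<and>
     F \<subseteq> possible_halfspaces (objective P) S \<and>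
     (\<forall>H\<in>F. \<forall>x\<in>feasible P. \<beta> *\<^sub>R objective P x \<in> H)"

fun remaining :: "'d::finite momilp \<Rightarrow> real list set \<Rightarrow> (real list, 'd) inner_state \<Rightarrow> nat" where
  "remaining P S (R, A, F) = card (S - R) + card (possible_halfspaces (objective P) S - F)"

lemma inner_invariant_init:
  "xinit \<in> S \<Longrightarrow> inner_invariant P S \<beta> (inner_init (objective P) xinit)"
  by (simp add: inner_init_def upper_hull_def)

lemma inner_step_progress:
  fixes P :: "'d::finite momilp"
  assumes step: "inner_step (objective P) \<epsilon> (hpO_WS P WS) \<sigma> \<sigma>'"
    and inv: "inner_invariant P S (\<alpha> * (1 + \<epsilon>)) \<sigma>"
    and P: "is_momilp P" and "\<epsilon> > 0" and ws: "ws_approximation \<alpha> P WS"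
    and S: "finite S" "S \<subseteq> feasible P" "WS ` {w. 0 \<le> w} \<subseteq> S"
  shows "inner_invariant P S (\<alpha> * (1 + \<epsilon>)) \<sigma>' \<and> remaining P S \<sigma>' < remaining P S \<sigma>"
  using step
proof cases
  case (inside H A F w c R)
  have R: "R \<noteq> {}" "R \<subseteq> S" and A: "A = upper_hull (objective P ` R)" using inv inside by auto
  have "0 \<le> w" using inside R A facet_halfspace_normal_nonneg[of "objective P ` R" w c] by simp
  then have v: "(1 + \<epsilon>) *\<^sub>R w \<noteq> 0" "0 \<le> (1 + \<epsilon>) *\<^sub>R w"
    using inside(4) \<open>\<epsilon> > 0\<close> by (auto simp: less_eq_vec_def)
  have "(\<alpha> * (1 + \<epsilon>)) *\<^sub>R objective P x \<in> H" if "x \<in> feasible P" for x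
    using hpO_WS_Inside[OF inside(6) ws v that] inside(5)
    by (simp add: halfspace_def mult.assoc)
  moreover have H: "H \<in> possible_halfspaces (objective P) S - F"
    using inside(3) R A unfolding possible_halfspaces_def by blast
  ultimately have "inner_invariant P S (\<alpha> * (1 + \<epsilon>)) \<sigma>'" using inv inside(1,2) by auto
  moreover have "card (possible_halfspaces (objective P) S - insert H F)
      < card (possible_halfspaces (objective P) S - F)"
    using H finite_possible_halfspaces[OF S(1), of "objective P"]
    by (intro psubset_card_mono) auto
  ultimately show ?thesis using inside(1,2) by simp
next
  case (not_inside H A F w c x R' R)
  have R: "R \<noteq> {}" "R \<subseteq> S" and A: "A = upper_hull (objective P ` R)" using inv not_inside by auto
  have w: "0 \<le> w" using not_inside R A facet_halfspace_normal_nonneg[of "objective P ` R" w c] by simp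
  then have v: "(1 + \<epsilon>) *\<^sub>R w \<noteq> 0" "0 \<le> (1 + \<epsilon>) *\<^sub>R w"
    using not_inside(4) \<open>\<epsilon> > 0\<close> by (auto simp: less_eq_vec_def)
  note x = hpO_WS_Not_Inside[OF not_inside(6) v]
  have xS: "x \<in> S" using x(1) S(3) by blast
  have "x \<notin> R"
  proof
    assume "x \<in> R"
    then have "objective P x \<in> A" using A upper_hull_add[of "objective P x" _ 0] by simp
    then have "c \<le> w \<bullet> objective P x"
      using not_inside(3,5) by (auto simp: facet_halfspaces_def halfspace_def)
    moreover have "0 \<le> objective P x" using P xS S(2) by (auto simp: is_momilp_def)
    then have "0 \<le> w \<bullet> objective P x"
      using w by (auto simp: inner_vec_def less_eq_vec_def intro!: sum_nonneg)
    then have "w \<bullet> objective P x \<le> (1 + \<epsilon>) * (w \<bullet> objective P x)"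
      using \<open>\<epsilon> > 0\<close> by (simp add: algebra_simps)
    ultimately show False using x(2) by simp
  qed
  then have "card (S - insert x R) < card (S - R)"
    using xS S(1) by (intro psubset_card_mono) auto
  moreover have "inner_invariant P S (\<alpha> * (1 + \<epsilon>)) \<sigma>'"
    using inv not_inside(1,2,7) xS by (auto simp: upper_hull_def)
  ultimately show ?thesis using not_inside(1,2,7) by simp
qed

lemma inner_step_exists:
  fixes f :: "'x \<Rightarrow> real ^ 'd::finite"
  assumes "facet_halfspaces A - F \<noteq> {}" "\<epsilon> > 0"
    and total: "\<And>v c. v \<noteq> 0 \<Longrightarrow> \<exists>a. hpO (halfspace v c) a"
  shows "\<exists>\<sigma>'. inner_step f \<epsilon> hpO (R, A, F) \<sigma>'"
proof -
  obtain H w c where H: "H \<in> facet_halfspaces A - F" "w \<noteq> 0" "H = halfspace w c"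
    using assms(1) unfolding facet_halfspaces_def by blast
  obtain a where "hpO (halfspace ((1 + \<epsilon>) *\<^sub>R w) c) a"
    using total[of "(1 + \<epsilon>) *\<^sub>R w"] H(2) assms(2) by auto
  then show ?thesis
    using H by (cases a) (auto intro: inner_step.intros)
qed

text \<open>
  Without unexplored facets, \<open>\<beta> f(x)\<close> lies in all facet-supporting halfspaces of the upper hull,
  hence in the upper hull.
\<close>

lemma inner_invariant_final:
  fixes P :: "'d::finite momilp"
  assumes inv: "inner_invariant P S \<beta> (R, A, F)" and final: "facet_halfspaces A - F = {}"
    and S: "finite S" "S \<subseteq> feasible P"
  shows "convex_approximation_set \<beta> P R"
  unfolding convex_approximation_set_def
proof (intro conjI ballI)
  show "R \<subseteq> feasible P" using inv S by auto
  fix x assume x: "x \<in> feasible P"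
  have R: "R \<noteq> {}" "finite R" and A: "A = upper_hull (objective P ` R)"
    using inv S finite_subset by auto
  have "\<beta> *\<^sub>R objective P x \<in> \<Inter>(facet_halfspaces A)" using inv final x by auto
  then have "\<beta> *\<^sub>R objective P x \<in> upper_hull (objective P ` R)"
    unfolding A
    by (subst (asm) Inter_facet_halfspaces) (simp_all add: R polyhedron_upper_hull interior_upper_hull)
  then obtain v z where "v \<in> convex hull (objective P ` R)" "0 \<le> z" "\<beta> *\<^sub>R objective P x = v + z"
    unfolding upper_hull_def by (auto elim: set_plus_elim)
  then show "\<exists>v\<in>convex hull (objective P ` R). v \<le> \<beta> *\<^sub>R objective P x"
    by (intro bexI[of _ v]) auto
qed

theorem theorem10:
  fixes \<I> :: "bool list set"
    and inst :: "bool list \<Rightarrow> 'd::finite momilp"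
    and WS :: "bool list \<Rightarrow> real ^ 'd \<Rightarrow> real list"
    and xinit :: "bool list \<Rightarrow> real list"
    and I :: "bool list"
    and \<epsilon> \<alpha> :: real
  assumes "I \<in> \<I>"
    and "is_momilp (inst I)"
    and "\<epsilon> > 0"
    and "\<alpha> > 1"
    and "ws_approximation \<alpha> (inst I) (WS I)"
    and "poly_encoding_length \<I> (\<lambda>J. WS J ` {w. 0 \<le> w})"
    and "xinit I \<in> feasible (inst I)"
    and "poly_encoding_length \<I> (\<lambda>J. {xinit J})"
  shows "inner_terminates (objective (inst I)) \<epsilon> (hpO_WS (inst I) (WS I)) (xinit I) \<and>
         (\<exists>R. inner_computes (objective (inst I)) \<epsilon> (hpO_WS (inst I) (WS I)) (xinit I) R) \<and>
         (\<forall>R. inner_computes (objective (inst I)) \<epsilon> (hpO_WS (inst I) (WS I)) (xinit I) R \<longrightarrow>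
           convex_approximation_set (\<alpha> * (1 + \<epsilon>)) (inst I) R)"
proof -
  let ?P = "inst I" and ?\<beta> = "\<alpha> * (1 + \<epsilon>)"
  let ?step = "inner_step (objective ?P) \<epsilon> (hpO_WS ?P (WS I))"
  let ?init = "inner_init (objective ?P) (xinit I)"
  define S where "S = insert (xinit I) (WS I ` {w. 0 \<le> w})"
  have S: "finite S" "S \<subseteq> feasible ?P" "WS I ` {w. 0 \<le> w} \<subseteq> S" "xinit I \<in> S"
    using finite_of_poly_encoding_length[OF assms(6,1)] assms(5,7)
    by (auto simp: S_def ws_approximation_def)
  have progress: "inner_invariant ?P S ?\<beta> \<sigma>' \<and> remaining ?P S \<sigma>' < remaining ?P S \<sigma>"
    if "?step \<sigma> \<sigma>'" "inner_invariant ?P S ?\<beta> \<sigma>" for \<sigma> \<sigma>'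
    using inner_step_progress[OF that assms(2,3,5) S(1-3)] .
  have reach: "inner_invariant ?P S ?\<beta> \<sigma>" if "?step\<^sup>*\<^sup>* ?init \<sigma>" for \<sigma>
    using that
  proof induction
    case base
    show ?case using S(4) by (rule inner_invariant_init)
  next
    case (step \<sigma> \<sigma>')
    then show ?case using progress by blast
  qed
  have "inner_terminates (objective ?P) \<epsilon> (hpO_WS ?P (WS I)) (xinit I)"
    unfolding inner_terminates_def
  proof
    assume "\<exists>\<sigma>. \<sigma> 0 = ?init \<and> (\<forall>i::nat. ?step (\<sigma> i) (\<sigma> (Suc i)))"
    then obtain \<sigma> where \<sigma>: "\<sigma> 0 = ?init" "\<And>i::nat. ?step (\<sigma> i) (\<sigma> (Suc i))" by blast
    have "?step\<^sup>*\<^sup>* ?init (\<sigma> i)" for i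
      by (induction i) (auto simp: \<sigma>(1) intro: rtranclp.rtrancl_into_rtrancl \<sigma>(2))
    then have "remaining ?P S (\<sigma> (Suc i)) < remaining ?P S (\<sigma> i)" for i
      using progress reach \<sigma>(2) by blast
    then show False
      using wf_iff_no_infinite_down_chain[of less_than] by (auto dest: spec[of _ "\<lambda>i. remaining ?P S (\<sigma> i)"])
  qed
  moreover have "\<exists>R. inner_computes (objective ?P) \<epsilon> (hpO_WS ?P (WS I)) (xinit I) R"
  proof -
    \<comment> \<open>A reachable state with the least possible measure admits no further step.\<close>
    obtain \<sigma> where \<sigma>: "?step\<^sup>*\<^sup>* ?init \<sigma>"
      and least: "\<And>\<sigma>'. ?step\<^sup>*\<^sup>* ?init \<sigma>' \<Longrightarrow> remaining ?P S \<sigma> \<le> remaining ?P S \<sigma>'"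
      using ex_has_least_nat[of "?step\<^sup>*\<^sup>* ?init" ?init "remaining ?P S"] by blast
    obtain R A F where RAF: "\<sigma> = (R, A, F)" by (cases \<sigma>)
    have "facet_halfspaces A - F = {}"
    proof (rule ccontr)
      assume "facet_halfspaces A - F \<noteq> {}"
      then obtain \<sigma>' where step: "?step \<sigma> \<sigma>'"
        using inner_step_exists[OF _ assms(3)] hpO_WS_total RAF by metis
      then have "remaining ?P S \<sigma> \<le> remaining ?P S \<sigma>'"
        using \<sigma> by (intro least) (rule rtranclp.rtrancl_into_rtrancl)
      then show False using progress[OF step reach[OF \<sigma>]] by simp
    qed
    then show ?thesis using \<sigma> RAF unfolding inner_computes_def by blast
  qed
  moreover have "convex_approximation_set ?\<beta> ?P R"
    if "inner_computes (objective ?P) \<epsilon> (hpO_WS ?P (WS I)) (xinit I) R" for R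
    using that inner_invariant_final[OF reach _ S(1,2)] unfolding inner_computes_def by blast
  ultimately show ?thesis by blast
qed

end
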